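(* Let $(\mathbb{X},\perp)$ be a $\perp$-restriction category with all binary $\perp$-joins and let $\circledast$ be an inductive Kleene wand on it. Then: (i) for any other Kleene wand $\circledast'$ on $(\mathbb{X},\perp)$, $f\circledast g\le f\circledast'g$ for all $f:X\to X$, $g:X\to A$ with $f\perp g$; (ii) $\circledast$ is the unique inductive Kleene wand on $(\mathbb{X},\perp)$.
   Context: Composition is diagrammatic: $fg$ means first $f$, then $g$. A restriction category is a category with an operator sending each $f:A\to B$ to $\overline{f}:A\to A$ such that $\overline{f}f=f$; $\overline{f}\,\overline{g}=\overline{g}\,\overline{f}$ and $\overline{\overline{g}f}=\overline{g}\,\overline{f}$ for $f:A\to B$, $g:A\to C$; and $f\overline{g}=\overline{fg}f$ for $f:A\to B$, $g:B\to C$. For parallel $f,g$: $f\le g$ iff $\overline{f}g=f$ (a partial order). Restriction zeroes: maps $0:A\to B$ with $f0=0=0f$ and $\overline{0}=0$. An interference relation $\perp$ on a restriction category with restriction zeroes is a family of relations between maps with the same domain such that: $1_A\perp 0$; $f\perp g\Rightarrow g\perp f$; $f\perp f\Rightarrow f=0$; $f'\perp g'$, $f\le f'$, $g\le g'$ imply $f\perp g$; $f\perp g\Rightarrow hfk\perp hgk'$ for all composable $h,k,k'$; $f\perp g\Rightarrow\overline{f}\perp\overline{g}$. A $\perp$-restriction category is a restriction category with restriction zeroes and a chosen interference relation $\perp$. It has all binary $\perp$-joins if any parallel $f\perp g:A\to B$ have a least upper bound $f\sqcup g$ for $\le$ and $h(f\sqcup g)=hf\sqcup hg$ for all $h:A'\to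 A$. A Kleene wand $\circledast$ on a $\perp$-restriction category with all binary $\perp$-joins assigns to each $f:X\to X$, $g:X\to A$ with $f\perp g$ a map $f\circledast g:X\to A$ such that: (1) if $f \perp g$, then $g\sqcup f(f\circledast g)=f\circledast g$; (2) $(f\circledast g)h=f\circledast gh$ for $f\perp g$, $h:A\to B$; (3) for $f:X\to Y$, $g:X\to A$, $k:Y\to X$ with $f\perp g$: $kf\circledast kg=k(fk\circledast g)$; (4) for $f,f':X\to X$, $g:X\to A$ with $f\perp f'$ and $f\sqcup f'\perp g$: $(f\circledast f')\perp(f\circledast g)$ and $(f\sqcup f')\circledast g=(f\circledast f')\circledast(f\circledast g)$. It is inductive if whenever $f:X\to X$, $g:X\to A$, $h:X\to A$ satisfy $f\perp g$, $fh\le h$ and $g\le h$, then $f\circledast g\le h$. *)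

theory Defs
  imports Main
begin

text \<open>Composition is diagrammatic throughout: \<open>f \<cdot> g\<close> is first \<open>f\<close>, then \<open>g\<close>.
  Every map has a unique domain and codomain. Operations are total functions on the
  underlying types and are only constrained on maps of the category that are composable
  (resp. of the appropriate type).\<close>

record ('o, 'm) cat =
  Obj :: "'o set"
  Arr :: "'m set"
  Dom :: "'m \<Rightarrow> 'o"
  Cod :: "'m \<Rightarrow> 'o"
  Id :: "'o \<Rightarrow> 'm"
  Comp :: "'m \<Rightarrow> 'm \<Rightarrow> 'm"  (infixl "\<cdot>\<index>" 70)

record ('o, 'm) perp_restr_cat = "('o, 'm) cat" +
  Restr :: "'m \<Rightarrow> 'm"
  Zero :: "'o \<Rightarrow> 'o \<Rightarrow> 'm"
  Perp :: "'m \<Rightarrow> 'm \<Rightarrow> bool"  (infix "\<bottom>\<index>" 50)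

definition homset :: "('o, 'm, 'x) cat_scheme \<Rightarrow> 'o \<Rightarrow> 'o \<Rightarrow> 'm set" where
  "homset C A B = {f \<in> Arr C. Dom C f = A \<and> Cod C f = B}"

locale category =
  fixes C :: "('o, 'm, 'x) cat_scheme" (structure)
  assumes Dom_Obj: "f \<in> Arr C \<Longrightarrow> Dom C f \<in> Obj C"
    and Cod_Obj: "f \<in> Arr C \<Longrightarrow> Cod C f \<in> Obj C"
    and Id_hom: "A \<in> Obj C \<Longrightarrow> Id C A \<in> homset C A A"
    and Comp_hom: "f \<in> homset C A B \<Longrightarrow> g \<in> homset C B D \<Longrightarrow> f \<cdot> g \<in> homset C A D"
    and Id_left: "f \<in> homset C A B \<Longrightarrow> Id C A \<cdot> f = f"
    and Id_right: "f \<in> homset C A B \<Longrightarrow> f \<cdot> Id C B = f"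
    and Comp_assoc: "f \<in> homset C A B \<Longrightarrow> g \<in> homset C B D \<Longrightarrow> h \<in> homset C D E
      \<Longrightarrow> (f \<cdot> g) \<cdot> h = f \<cdot> (g \<cdot> h)"

locale restriction_category = category C
  for C :: "('o, 'm, 'x) perp_restr_cat_scheme" (structure) +
  assumes Restr_hom: "f \<in> homset C A B \<Longrightarrow> Restr C f \<in> homset C A A"
    and Restr_left: "f \<in> homset C A B \<Longrightarrow> Restr C f \<cdot> f = f"
    and Restr_commute: "f \<in> homset C A B \<Longrightarrow> g \<in> homset C A D
      \<Longrightarrow> Restr C f \<cdot> Restr C g = Restr C g \<cdot> Restr C f"
    and Restr_Restr: "f \<in> homset C A B \<Longrightarrow> g \<in> homset C A D
      \<Longrightarrow> Restr C (Restr C g \<cdot> f) = Restr C g \<cdot> Restr C f"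
    and Comp_Restr: "f \<in> homset C A B \<Longrightarrow> g \<in> homset C B D
      \<Longrightarrow> f \<cdot> Restr C g = Restr C (f \<cdot> g) \<cdot> f"

definition restr_le :: "('o, 'm, 'x) perp_restr_cat_scheme \<Rightarrow> 'm \<Rightarrow> 'm \<Rightarrow> bool"
    (infix "\<preceq>\<index>" 50) where
  "f \<preceq>\<^bsub>C\<^esub> g \<longleftrightarrow> f \<in> Arr C \<and> g \<in> Arr C \<and> Dom C f = Dom C g \<and> Cod C f = Cod C g
     \<and> Restr C f \<cdot>\<^bsub>C\<^esub> g = f"

locale restriction_category_with_zeroes = restriction_category C
  for C :: "('o, 'm, 'x) perp_restr_cat_scheme" (structure) +
  assumes Zero_hom: "A \<in> Obj C \<Longrightarrow> B \<in> Obj C \<Longrightarrow> Zero C A B \<in> homset C A B"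
    and Comp_Zero: "f \<in> homset C A B \<Longrightarrow> D \<in> Obj C \<Longrightarrow> f \<cdot> Zero C B D = Zero C A D"
    and Zero_Comp: "A \<in> Obj C \<Longrightarrow> f \<in> homset C B D \<Longrightarrow> Zero C A B \<cdot> f = Zero C A D"
    and Restr_Zero: "A \<in> Obj C \<Longrightarrow> B \<in> Obj C \<Longrightarrow> Restr C (Zero C A B) = Zero C A A"

locale perp_restriction_category = restriction_category_with_zeroes C
  for C :: "('o, 'm, 'x) perp_restr_cat_scheme" (structure) +
  assumes Perp_same_Dom: "f \<bottom> g \<Longrightarrow> f \<in> Arr C \<and> g \<in> Arr C \<and> Dom C f = Dom C g"
    and Id_Perp_Zero: "A \<in> Obj C \<Longrightarrow> B \<in> Obj C \<Longrightarrow> Id C A \<bottom> Zero C A B"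
    and Perp_sym: "f \<bottom> g \<Longrightarrow> g \<bottom> f"
    and Perp_self: "f \<bottom> f \<Longrightarrow> f = Zero C (Dom C f) (Cod C f)"
    and Perp_mono: "f' \<bottom> g' \<Longrightarrow> f \<preceq> f' \<Longrightarrow> g \<preceq> g' \<Longrightarrow> f \<bottom> g"
    and Perp_Comp: "f \<bottom> g \<Longrightarrow> f \<in> homset C A B \<Longrightarrow> g \<in> homset C A D
      \<Longrightarrow> h \<in> homset C A' A \<Longrightarrow> k \<in> homset C B B' \<Longrightarrow> k' \<in> homset C D D'
      \<Longrightarrow> h \<cdot> f \<cdot> k \<bottom> h \<cdot> g \<cdot> k'"
    and Perp_Restr: "f \<bottom> g \<Longrightarrow> Restr C f \<bottom> Restr C g"

definition is_join :: "('o, 'm, 'x) perp_restr_cat_scheme \<Rightarrow> 'm \<Rightarrow> 'm \<Rightarrow> 'm \<Rightarrow> bool" where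
  "is_join C f g u \<longleftrightarrow> f \<preceq>\<^bsub>C\<^esub> u \<and> g \<preceq>\<^bsub>C\<^esub> u \<and>
     (\<forall>v. f \<preceq>\<^bsub>C\<^esub> v \<and> g \<preceq>\<^bsub>C\<^esub> v \<longrightarrow> u \<preceq>\<^bsub>C\<^esub> v)"

definition join :: "('o, 'm, 'x) perp_restr_cat_scheme \<Rightarrow> 'm \<Rightarrow> 'm \<Rightarrow> 'm"
    (infixl "\<squnion>\<index>" 65) where
  "f \<squnion>\<^bsub>C\<^esub> g = (THE u. is_join C f g u)"

locale perp_restriction_category_with_joins = perp_restriction_category C
  for C :: "('o, 'm, 'x) perp_restr_cat_scheme" (structure) +
  assumes join_exists: "f \<in> homset C A B \<Longrightarrow> g \<in> homset C A B \<Longrightarrow> f \<bottom> g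
      \<Longrightarrow> \<exists>u. is_join C f g u"
    and Comp_join: "f \<in> homset C A B \<Longrightarrow> g \<in> homset C A B \<Longrightarrow> f \<bottom> g \<Longrightarrow> h \<in> homset C A' A
      \<Longrightarrow> h \<cdot> (f \<squnion> g) = h \<cdot> f \<squnion> h \<cdot> g"

text \<open>A wand is represented by a total binary function; its values are only meaningful on
  pairs \<open>f : X \<rightarrow> X\<close>, \<open>g : X \<rightarrow> A\<close> with \<open>f \<bottom> g\<close>.\<close>

locale kleene_wand = perp_restriction_category_with_joins C
  for C :: "('o, 'm, 'x) perp_restr_cat_scheme" (structure) +
  fixes wand :: "'m \<Rightarrow> 'm \<Rightarrow> 'm"  (infixl "\<star>" 60)
  assumes wand_hom: "f \<in> homset C X X \<Longrightarrow> g \<in> homset C X A \<Longrightarrow> f \<bottom> g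
      \<Longrightarrow> f \<star> g \<in> homset C X A"
    and wand_unfold: "f \<in> homset C X X \<Longrightarrow> g \<in> homset C X A \<Longrightarrow> f \<bottom> g
      \<Longrightarrow> g \<squnion> f \<cdot> (f \<star> g) = f \<star> g"
    and wand_Comp: "f \<in> homset C X X \<Longrightarrow> g \<in> homset C X A \<Longrightarrow> f \<bottom> g \<Longrightarrow> h \<in> homset C A B
      \<Longrightarrow> (f \<star> g) \<cdot> h = f \<star> (g \<cdot> h)"
    and wand_slide: "f \<in> homset C X Y \<Longrightarrow> g \<in> homset C X A \<Longrightarrow> k \<in> homset C Y X \<Longrightarrow> f \<bottom> g
      \<Longrightarrow> (k \<cdot> f) \<star> (k \<cdot> g) = k \<cdot> ((f \<cdot> k) \<star> g)"
    and wand_Perp_wand: "f \<in> homset C X X \<Longrightarrow> f' \<in> homset C X X \<Longrightarrow> g \<in> homset C X A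
      \<Longrightarrow> f \<bottom> f' \<Longrightarrow> (f \<squnion> f') \<bottom> g \<Longrightarrow> (f \<star> f') \<bottom> (f \<star> g)"
    and join_wand: "f \<in> homset C X X \<Longrightarrow> f' \<in> homset C X X \<Longrightarrow> g \<in> homset C X A
      \<Longrightarrow> f \<bottom> f' \<Longrightarrow> (f \<squnion> f') \<bottom> g \<Longrightarrow> (f \<squnion> f') \<star> g = (f \<star> f') \<star> (f \<star> g)"

locale inductive_kleene_wand = kleene_wand C wand
  for C :: "('o, 'm, 'x) perp_restr_cat_scheme" (structure)
    and wand :: "'m \<Rightarrow> 'm \<Rightarrow> 'm"  (infixl "\<star>" 60) +
  assumes wand_induct: "f \<in> homset C X X \<Longrightarrow> g \<in> homset C X A \<Longrightarrow> h \<in> homset C X A \<Longrightarrow> f \<bottom> g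
      \<Longrightarrow> f \<cdot> h \<preceq> h \<Longrightarrow> g \<preceq> h \<Longrightarrow> f \<star> g \<preceq> h"

end

theory Submission
  imports Defs
begin

text \<open>For any Kleene wand, the unfolding axiom exhibits \<open>f \<star> g\<close> as the join
  of \<open>g\<close> and \<open>f \<cdot> (f \<star> g)\<close>, hence as an upper bound of both
  (\<open>wand_prefixed_point\<close>). These two inequalities are exactly what the induction rule
  of an inductive wand asks of \<open>h\<close>, so an inductive wand lies below every wand
  (\<open>wand_least\<close>). Two inductive wands therefore lie below each other and agree by
  antisymmetry of the restriction order.\<close>

lemma (in restriction_category) restr_le_antisym:
  assumes "f \<preceq> g" and "g \<preceq> f"
  shows "f = g"
proof -
  have f: "f \<in> homset C (Dom C f) (Cod C f)" and g: "g \<in> homset C (Dom C f) (Cod C f)"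
    using assms by (auto simp: restr_le_def homset_def)
  have fg: "Restr C f \<cdot> g = f" and gf: "Restr C g \<cdot> f = g"
    using assms by (auto simp: restr_le_def)
  \<comment> \<open>The two inequalities rewrite \<open>f\<close> with both restrictions in front;
    since these commute, \<open>Restr C f\<close> can be moved next to \<open>f\<close> and
    absorbed.\<close>
  have "f = Restr C f \<cdot> (Restr C g \<cdot> f)"
    using fg gf by simp
  also have "\<dots> = Restr C g \<cdot> (Restr C f \<cdot> f)"
    using Comp_assoc[OF Restr_hom[OF f] Restr_hom[OF g] f]
      Comp_assoc[OF Restr_hom[OF g] Restr_hom[OF f] f] Restr_commute[OF f g] by simp
  also have "\<dots> = g"
    using Restr_left[OF f] gf by simp
  finally show ?thesis .
qed

text \<open>Antisymmetry makes least upper bounds unique, so the definite description behind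
  \<open>\<squnion>\<close> really denotes the join whose existence is assumed.\<close>

lemma (in perp_restriction_category_with_joins) is_join_join:
  assumes "f \<in> homset C A B" and "g \<in> homset C A B" and "f \<bottom> g"
  shows "is_join C f g (f \<squnion> g)"
proof -
  obtain u where u: "is_join C f g u"
    using join_exists[OF assms] by blast
  show ?thesis
    unfolding join_def
  proof (rule theI[where P = "is_join C f g", OF u])
    fix v assume "is_join C f g v"
    with u show "v = u"
      by (auto simp: is_join_def intro: restr_le_antisym)
  qed
qed

text \<open>Both are the upper-bound half of the join in \<open>wand_unfold\<close>. That this join
  is genuine requires its two arguments to interfere, in the sense of
  \<open>\<bottom>\<close>.\<close>

lemma (in kleene_wand) wand_prefixed_point:
  assumes f: "f \<in> homset C X X" and g: "g \<in> homset C X A" and "f \<bottom> g"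
  shows "g \<preceq> f \<star> g" and "f \<cdot> (f \<star> g) \<preceq> f \<star> g"
proof -
  have w: "f \<star> g \<in> homset C X A"
    using assms by (rule wand_hom)
  have X: "Id C X \<in> homset C X X" and A: "Id C A \<in> homset C A A"
    using g Dom_Obj Cod_Obj Id_hom by (auto simp: homset_def)
  \<comment> \<open>Only one side is to be extended, by \<open>f \<star> g\<close>; identities fill
    the other slots of \<open>Perp_Comp\<close>.\<close>
  have "Id C X \<cdot> g \<cdot> Id C A \<bottom> Id C X \<cdot> f \<cdot> (f \<star> g)"
    using Perp_Comp[OF Perp_sym[OF \<open>f \<bottom> g\<close>] g f X A w] .
  then have "g \<bottom> f \<cdot> (f \<star> g)"
    using Id_left[OF f] Id_left[OF g] Id_right[OF g] by simp
  then have "is_join C g (f \<cdot> (f \<star> g)) (f \<star> g)"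
    using is_join_join[OF g Comp_hom[OF f w]] wand_unfold[OF assms] by simp
  then show "g \<preceq> f \<star> g" and "f \<cdot> (f \<star> g) \<preceq> f \<star> g"
    by (auto simp: is_join_def)
qed

lemma (in inductive_kleene_wand) wand_least:
  assumes "kleene_wand C wand'"
    and "f \<in> homset C X X" and "g \<in> homset C X A" and "f \<bottom> g"
  shows "f \<star> g \<preceq> wand' f g"
proof -
  interpret other: kleene_wand C wand' by fact
  show ?thesis
    using assms(2-) by (intro wand_induct other.wand_hom other.wand_prefixed_point)
qed

theorem lemma5p14:
  fixes C :: "('o, 'm) perp_restr_cat" (structure)
    and wand :: "'m \<Rightarrow> 'm \<Rightarrow> 'm"
  assumes "perp_restriction_category_with_joins C"
    and "inductive_kleene_wand C wand"
  shows "(\<forall>wand'. kleene_wand C wand' \<longrightarrow>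
      (\<forall>X A. \<forall>f \<in> homset C X X. \<forall>g \<in> homset C X A. f \<bottom> g \<longrightarrow> wand f g \<preceq> wand' f g)) \<and>
    (\<forall>wand'. inductive_kleene_wand C wand' \<longrightarrow>
      (\<forall>X A. \<forall>f \<in> homset C X X. \<forall>g \<in> homset C X A. f \<bottom> g \<longrightarrow> wand' f g = wand f g))"
proof -
  interpret inductive_kleene_wand C wand by fact
  \<comment> \<open>The situation is symmetric: \<open>wand_least\<close> applies with either wand
    as the inductive one.\<close>
  have "wand' f g = wand f g"
    if "inductive_kleene_wand C wand'" "f \<in> homset C X X" "g \<in> homset C X A" "f \<bottom> g"
    for wand' X A f g
  proof -
    interpret other: inductive_kleene_wand C wand' by fact
    show ?thesis
      using that(2-) wand_least[OF other.kleene_wand_axioms]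
        other.wand_least[OF kleene_wand_axioms]
      by (blast intro: restr_le_antisym)
  qed
  then show ?thesis
    using wand_least by blast
qed

end
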